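(* Let $k\geq 1$ be an integer. For each $n\ge 1$ let $X_n$ be a set of $n$ independent uniform random points in the unit square $[0,1]^2$, let $L^k_n$ be the maximal length of a chain $(p_1,\dots,p_m)$ of points of $X_n$ such that $(\gamma_k(0)^{\circ k},p_1,\dots,p_m,\gamma_k(1)^{\circ k})$ is a $k$-monotone chain, and let $\alpha_k=\lim_{n\to\infty} n^{-1/(k+1)}\,\mathbb{E}L^k_n$ (this limit exists and is a positive constant). Then $\alpha_k\geq \frac16$.
   Context: Notation: $\gamma_k(x)=(x,x^k)$ for $x\ge 0$, and $p^{\circ i}$ denotes the point $p$ repeated $i$ times. A chain is a sequence of points whose $x$-coordinates are increasing (repeated copies of the same point are allowed only where explicitly indicated, and are listed consecutively). The length of a chain $(p_1,\dots,p_m)$ is $m$; the empty chain has length $0$. Divided differences: for points $p_i=(x_i,y_i)$, $\Delta_0(p_i)=y_i$ and $$\Delta_j(p_i,\dots,p_{i+j})=\frac{\Delta_{j-1}(p_{i+1},\dots,p_{i+j})-\Delta_{j-1}(p_i,\dots,p_{i+j-1})}{x_{i+j}-x_i}.$$ For multisets, all repeated points are required to lie on the graph of the function $f(x)=x^k$; one sets $\Delta_i(p^{\circ(i+1)})=f^{(i)}(x)/i!$ for $p=(x,f(x))$, and otherwise uses the recursion for $\Delta_j$ with the points listed in nondecreasing order of $x$-coordinates. A $(k+1)$-tuple is positive if its $k$-th divided difference $\Delta_k$ is nonnegative (for distinct points this is equivalent to the tuple lying on the graph of a function whose $k$-th derivative exists everywhere and is nowhere negative). A chain (possibly with repeated points,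 all of which lie on the graph of $f(x)=x^k$) is $k$-monotone if every $(k+1)$-tuple of its members, counted with multiplicity, is positive. With probability 1 the points of $X_n$ have distinct $x$-coordinates and no $k+1$ of them lie on the graph of a polynomial of degree at most $k-1$; this is assumed throughout. *)

theory Defs
  imports "HOL-Probability.Probability" "HOL-Library.Sublist"
begin

type_synonym point = "real \<times> real"

definition gam :: "nat \<Rightarrow> real \<Rightarrow> point" where
  "gam k x = (x, x ^ k)"

text \<open>
  \<open>div_diff k j [p\<^sub>0, \<dots>, p\<^sub>j]\<close> is the \<open>j\<close>-th divided difference. The points are meant to be
  listed in nondecreasing order of their first coordinates, and repeated points are meant to lie on
  the graph of \<open>f(x) = x ^ k\<close>; the parameter \<open>k\<close> only enters through the confluent values
  \<open>f\<^sup>(\<^sup>j\<^sup>)(x) / j!\<close>.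
\<close>
primrec div_diff :: "nat \<Rightarrow> nat \<Rightarrow> point list \<Rightarrow> real" where
  "div_diff k 0 ps = snd (hd ps)"
| "div_diff k (Suc j) ps =
     (if \<forall>p \<in> set ps. p = hd ps
      then (deriv ^^ Suc j) (\<lambda>t::real. t ^ k) (fst (hd ps)) / fact (Suc j)
      else (div_diff k j (tl ps) - div_diff k j (butlast ps)) / (fst (last ps) - fst (hd ps)))"

definition positive_tuple :: "nat \<Rightarrow> point list \<Rightarrow> bool" where
  "positive_tuple k ps \<longleftrightarrow> length ps = k + 1 \<and> 0 \<le> div_diff k k ps"

definition chain :: "point list \<Rightarrow> bool" where
  "chain ps \<longleftrightarrow> sorted_wrt (\<lambda>p q. fst p < fst q) ps"

definition multichain :: "nat \<Rightarrow> point list \<Rightarrow> bool" where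
  "multichain k ps \<longleftrightarrow>
     sorted_wrt (\<lambda>p q. fst p < fst q \<or> (p = q \<and> p = gam k (fst p))) ps"

text \<open>
  The \<open>(k + 1)\<close>-tuples of members, counted with multiplicity, are the (not necessarily contiguous)
  subsequences of length \<open>k + 1\<close>; they inherit the order of the \<open>x\<close>-coordinates.
\<close>
definition k_monotone :: "nat \<Rightarrow> point list \<Rightarrow> bool" where
  "k_monotone k ps \<longleftrightarrow>
     multichain k ps \<and> (\<forall>qs. subseq qs ps \<and> length qs = k + 1 \<longrightarrow> positive_tuple k qs)"

text \<open>
  The first conjunct says that no copies of the two end points are present beyond the \<open>k\<close> explicitly
  added ones, that is, all \<open>x\<close>-coordinates in \<open>ps\<close> lie strictly between 0 and 1.
\<close>
definition admissible :: "nat \<Rightarrow> point list \<Rightarrow> bool" where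
  "admissible k ps \<longleftrightarrow>
     chain (gam k 0 # ps @ [gam k 1]) \<and>
     k_monotone k (replicate k (gam k 0) @ ps @ replicate k (gam k 1))"

definition max_chain_length :: "nat \<Rightarrow> point set \<Rightarrow> nat" where
  "max_chain_length k X = Max {length ps | ps. set ps \<subseteq> X \<and> admissible k ps}"

end

theory Submission
  imports Defs
begin

text \<open>
  Idea: thin vertical cells around the curve \<open>y = x ^ k\<close>, of width \<open>w\<close> and half-height \<open>h\<close>, are
  placed at horizontal gaps \<open>\<delta>\<close>. A divided difference is linear in the ordinates, and on the curve
  itself the \<open>k\<close>-th one equals 1. Moving the ordinates by at most \<open>h\<close> at nodes that are \<open>\<delta>\<close>-separated
  changes it by at most \<open>\<Sum>i. h / (i! (k - i)! \<delta>^k) = h 2^k / (k! \<delta>^k)\<close>. So for \<open>h = k! (\<delta>/2)^k\<close>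
  picking one point from every occupied cell always gives an admissible chain. With cells repeating
  at period \<open>w + \<delta> = 2 n^(-1/(k+1))\<close> and \<open>w = (w + \<delta>)/(k + 1)\<close>, a cell has area at least
  \<open>2/(3n)\<close>, hence is occupied with probability at least \<open>1 - exp(-2/3) \<ge> 2/5\<close>. Using only the
  abscissae in \<open>[1/16, 15/16]\<close> this gives \<open>\<alpha> \<ge> 7/8 \<cdot> 1/2 \<cdot> 2/5 = 7/40\<close>.
\<close>

subsection \<open>Divided differences of perturbed powers\<close>

text \<open>The complete homogeneous symmetric polynomial of degree \<open>m\<close> in the entries of the list.\<close>

fun hsym :: "nat \<Rightarrow> real list \<Rightarrow> real" where
  "hsym 0 xs = 1"
| "hsym (Suc m) [] = 0"
| "hsym (Suc m) (x # xs) = hsym (Suc m) xs + x * hsym m (x # xs)"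

text \<open>The recursion of \<open>hsym\<close> peels the first variable, and divided differences
  need the last one peeled too. Both peelings commute; the outer induction on the degree supplies
  the term common to both expansions.\<close>

lemma hsym_snoc: "hsym (Suc m) (xs @ [y]) = hsym (Suc m) xs + y * hsym m (xs @ [y])"
proof (induction m arbitrary: xs)
  case 0
  show ?case by (induction xs) auto
next
  case (Suc m)
  show ?case
  proof (induction xs)
    case Nil
    show ?case by simp
  next
    case (Cons x xs)
    define d where "d = hsym m (x # xs @ [y])"
    have 1: "hsym (Suc m) (x # xs @ [y]) = hsym (Suc m) (x # xs) + y * d"
      using Suc.IH[of "x # xs"] by (simp add: d_def)
    have "hsym (Suc (Suc m)) ((x # xs) @ [y])
        = hsym (Suc (Suc m)) (xs @ [y]) + x * (hsym (Suc m) (x # xs) + y * d)"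
      unfolding 1[symmetric] by simp
    also have "\<dots> = hsym (Suc (Suc m)) (x # xs) + y * (hsym (Suc m) (xs @ [y]) + x * d)"
      unfolding Cons.IH by (simp add: algebra_simps)
    finally show ?case by (simp add: d_def)
  qed
qed

text \<open>Peeling \<open>x\<close> at the front or \<open>z\<close> at the back expands the same
  polynomial of the full list in two ways. The result is the recursion of divided differences, so
  those of \<open>t ^ k\<close> are complete homogeneous polynomials in the nodes.\<close>

lemma hsym_diff:
  "hsym (Suc m) (xs @ [z]) - hsym (Suc m) (x # xs) = (z - x) * hsym m (x # xs @ [z])"
  using hsym_snoc[of m "x # xs" z] by (simp add: algebra_simps)

text \<open>Counts the monomials of degree \<open>m\<close> in \<open>j + 1\<close> variables, by
  Pascal's rule. For \<open>m = k - j\<close> this is the confluent value prescribed by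
  \<open>div_diff\<close>.\<close>

lemma hsym_replicate: "hsym m (replicate (Suc j) x) = real ((m + j) choose j) * x ^ m"
proof (induction j arbitrary: m)
  case 0
  show ?case by (induction m) auto
next
  case (Suc j)
  show ?case
  proof (induction m)
    case 0
    show ?case by simp
  next
    case (Suc m)
    have "hsym (Suc m) (replicate (Suc (Suc j)) x)
        = hsym (Suc m) (replicate (Suc j) x) + x * hsym m (replicate (Suc (Suc j)) x)"
      by simp
    also have "\<dots> = real ((Suc m + j) choose j) * x ^ Suc m
        + x * (real ((m + Suc j) choose Suc j) * x ^ m)"
      using Suc.IH \<open>\<And>m. hsym m (replicate (Suc j) x) = _ m\<close> by metis
    finally show ?case by (simp add: algebra_simps)
  qed
qed

lemma higher_deriv_power_real:
  "j \<le> k \<Longrightarrow> (deriv ^^ j) (\<lambda>t::real. t ^ k) = (\<lambda>t. fact k / fact (k - j) * t ^ (k - j))"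
proof (induction j)
  case 0
  show ?case by simp
next
  case (Suc j)
  define m where "m = k - Suc j"
  have m: "k - j = Suc m" using Suc.prems by (simp add: m_def)
  have "deriv (\<lambda>t::real. fact k / fact (Suc m) * t ^ Suc m) t = fact k / fact m * t ^ m" for t
  proof (rule DERIV_imp_deriv)
    have "((\<lambda>t::real. fact k / fact (Suc m) * t ^ Suc m) has_real_derivative
        fact k / fact (Suc m) * (real (Suc m) * t ^ m)) (at t)"
      by (rule derivative_eq_intros refl | simp)+
    moreover have "fact k / fact (Suc m) * (real (Suc m) * t ^ m) = fact k / fact m * t ^ m"
      unfolding fact_Suc of_nat_mult by (simp del: of_nat_Suc)
    ultimately show "((\<lambda>t::real. fact k / fact (Suc m) * t ^ Suc m) has_real_derivative
        fact k / fact m * t ^ m) (at t)"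
      by simp
  qed
  moreover have "(deriv ^^ j) (\<lambda>t::real. t ^ k) = (\<lambda>t. fact k / fact (Suc m) * t ^ Suc m)"
    using Suc m by (simp del: fact_Suc power_Suc)
  ultimately show ?case unfolding m_def[symmetric] by (simp del: fact_Suc power_Suc)
qed

section \<open>Lagrange form of the contribution of the errors\<close>

text \<open>Holds term by term: dropping node 0 or node j+1 from the full product and subtracting
  the reciprocals leaves (x_i - x_0) - (x_i - x_{j+1}) = x_{j+1} - x_0 over the full product. Nodes
  may coincide where the error vanishes, since there the numerator is 0.\<close>

lemma node_error_rec:
  fixes e x :: "nat \<Rightarrow> real"
  assumes ne: "x (Suc j) \<noteq> x 0"
    and simple: "\<And>i l. i \<le> Suc j \<Longrightarrow> l \<le> Suc j \<Longrightarrow> l \<noteq> i \<Longrightarrow> e i \<noteq> 0 \<Longrightarrow> x i \<noteq> x l"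
  shows "(\<Sum>i\<le>j. e (Suc i) / (\<Prod>l\<in>{..j}-{i}. x (Suc i) - x (Suc l)))
       - (\<Sum>i\<le>j. e i / (\<Prod>l\<in>{..j}-{i}. x i - x l))
       = (x (Suc j) - x 0) * (\<Sum>i\<le>Suc j. e i / (\<Prod>l\<in>{..Suc j}-{i}. x i - x l))"
proof -
  \<comment> \<open>Both sums are extended to the common range \<open>{..Suc j}\<close>.
    \<open>A\<close> lacks node \<open>0\<close> and \<open>B\<close> lacks node
    \<open>Suc j\<close>, so these terms are set to 0.\<close>
  define A where "A i = (if i = 0 then 0 else e i / (\<Prod>l\<in>{1..Suc j}-{i}. x i - x l))" for i
  define B where "B i = (if i = Suc j then 0 else e i / (\<Prod>l\<in>{..j}-{i}. x i - x l))" for i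
  have A: "(\<Sum>i\<le>j. e (Suc i) / (\<Prod>l\<in>{..j}-{i}. x (Suc i) - x (Suc l))) = (\<Sum>i\<le>Suc j. A i)"
  proof -
    have "(\<Prod>l\<in>{..j}-{i}. x (Suc i) - x (Suc l)) = (\<Prod>l\<in>{1..Suc j}-{Suc i}. x (Suc i) - x l)" for i
    proof (rule prod.reindex_bij_witness[of _ "\<lambda>l. l - 1" Suc], goal_cases)
      case (4 a) then show ?case by (cases a) auto
    next
      case (3 a) then show ?case by (cases a) auto
    qed auto
    then show ?thesis
      by (subst sum.atMost_Suc_shift) (simp add: A_def)
  qed
  have B: "(\<Sum>i\<le>j. e i / (\<Prod>l\<in>{..j}-{i}. x i - x l)) = (\<Sum>i\<le>Suc j. B i)"
    by (simp add: B_def)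
  have *: "A i - B i = (x (Suc j) - x 0) * (e i / (\<Prod>l\<in>{..Suc j}-{i}. x i - x l))"
    if i: "i \<le> Suc j" for i
  proof (cases "e i = 0")
    case True
    then show ?thesis unfolding A_def B_def by (auto split: if_splits)
  next
    case False
    then have nz: "x i \<noteq> x l" if "l \<le> Suc j" "l \<noteq> i" for l using simple i that by blast
    consider "i = 0" | "i = Suc j" | "0 < i" "i \<le> j" using i by linarith
    then show ?thesis
    proof cases
      case 1
      have "{..Suc j} - {0} = insert (Suc j) ({..j} - {0})" by auto
      then have "(\<Prod>l\<in>{..Suc j}-{0}. x 0 - x l) = (x 0 - x (Suc j)) * (\<Prod>l\<in>{..j}-{0}. x 0 - x l)"
        by simp
      moreover have "x 0 - x (Suc j) \<noteq> 0" using ne by simp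
      ultimately show ?thesis using 1 
        by (simp add: A_def B_def divide_simps) (simp add: algebra_simps)
    next
      case 2
      have "{..Suc j} - {Suc j} = insert 0 ({1..Suc j} - {Suc j})" by auto
      then have "(\<Prod>l\<in>{..Suc j}-{Suc j}. x (Suc j) - x l)
          = (x (Suc j) - x 0) * (\<Prod>l\<in>{1..Suc j}-{Suc j}. x (Suc j) - x l)"
        by (metis (no_types, lifting) Diff_iff atLeastAtMost_iff finite_Diff finite_atLeastAtMost not_one_le_zero prod.insert)
      moreover have "x (Suc j) - x 0 \<noteq> 0" using ne by simp
      ultimately show ?thesis using 2 
        by (simp add: A_def B_def)
    next
      case 3
      define P where "P = (\<Prod>l\<in>{1..j}-{i}. x i - x l)"
      have a: "{1..Suc j} - {i} = insert (Suc j) ({1..j} - {i})"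
        and b: "{..j} - {i} = insert 0 ({1..j} - {i})"
        and c: "{..Suc j} - {i} = insert 0 (insert (Suc j) ({1..j} - {i}))" using 3 by auto
      have "(\<Prod>l\<in>{1..Suc j}-{i}. x i - x l) = (x i - x (Suc j)) * P"
        "(\<Prod>l\<in>{..j}-{i}. x i - x l) = (x i - x 0) * P"
        "(\<Prod>l\<in>{..Suc j}-{i}. x i - x l) = (x i - x 0) * ((x i - x (Suc j)) * P)"
        unfolding a b c by (auto simp: P_def)
      moreover have "P \<noteq> 0" unfolding P_def using nz by (auto simp: prod_zero_iff)
      moreover have "x i - x 0 \<noteq> 0" "x i - x (Suc j) \<noteq> 0" using nz 3 by auto
      ultimately show ?thesis using 3
        by (simp add: A_def B_def divide_simps) (simp add: algebra_simps)
    qed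
  qed
  show ?thesis
    unfolding A B sum_distrib_left sum_subtractf[symmetric]
    by (intro sum.cong refl *) auto
qed

text \<open>
  Repeated nodes lie on the curve, so they contribute \<open>0 / 0 = 0\<close> to the sum.
\<close>

lemma div_diff_multichain:
  assumes "multichain k ps" "length ps = Suc j" "j \<le> k"
  shows "div_diff k j ps = hsym (k - j) (map fst ps)
    + (\<Sum>i\<le>j. (snd (ps ! i) - fst (ps ! i) ^ k) / (\<Prod>l\<in>{..j}-{i}. fst (ps ! i) - fst (ps ! l)))"
  using assms
proof (induction j arbitrary: ps)
  case 0
  then obtain p where "ps = [p]" by (auto simp: length_Suc_conv)
  then show ?case using hsym_replicate[of k 0 "fst p"] by simp
next
  case (Suc j)
  define x where "x i = fst (ps ! i)" for i
  define e where "e i = snd (ps ! i) - fst (ps ! i) ^ k" for i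
  have pair: "x i < x l \<or> (ps ! i = ps ! l \<and> e i = 0)" if "i < l" "l \<le> Suc j" for i l
    using Suc.prems(1,2) that
    by (auto simp: multichain_def sorted_wrt_iff_nth_less gam_def x_def e_def split: prod.splits)
       (metis gam_def snd_conv fst_conv less_Suc_eq_le cancel_comm_monoid_add_class.diff_cancel)+
  have simple: "x i \<noteq> x l" if "i \<le> Suc j" "l \<le> Suc j" "l \<noteq> i" "e i \<noteq> 0" for i l
    using pair[of i l] pair[of l i] that by (metis e_def linorder_neq_iff order_less_irrefl)
  show ?case
  proof (cases "\<forall>p\<in>set ps. p = hd ps")
    case True
    then have rep: "ps = replicate (Suc (Suc j)) (hd ps)"
      using Suc.prems(2) by (metis replicate_eqI)
    have eq: "ps ! i = ps ! l" if "i \<le> Suc j" "l \<le> Suc j" for i l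
      using True that Suc.prems(2) by (metis less_Suc_eq_le nth_mem)
    \<comment> \<open>All nodes coincide and there are at least two, so each is repeated and lies on
      the curve. The error sum vanishes and only the binomial value remains.\<close>
    have e0: "e i = 0" if "i \<le> Suc j" for i
    proof -
      obtain l where "l \<le> Suc j" "l \<noteq> i" by (metis le0 order_refl zero_neq_one One_nat_def Suc_le_mono)
      then show ?thesis using simple[of i l] that eq[of i l] by (auto simp: x_def)
    qed
    have "div_diff k (Suc j) ps = fact k / fact (k - Suc j) / fact (Suc j) * fst (hd ps) ^ (k - Suc j)"
      using True Suc.prems(3) by (simp add: higher_deriv_power_real del: funpow.simps)
    also have "\<dots> = hsym (k - Suc j) (replicate (Suc (Suc j)) (fst (hd ps)))"
      unfolding hsym_replicate using Suc.prems(3) 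
      by (simp add: binomial_fact del: replicate.simps)
    also have "replicate (Suc (Suc j)) (fst (hd ps)) = map fst ps"
      by (subst rep) simp
    finally show ?thesis using e0 by (simp add: e_def)
  next
    case False
    obtain p ms q where ps: "ps = p # ms @ [q]" 
      using Suc.prems(2) by (cases ps; cases "tl ps" rule: rev_cases) auto
    have len: "length ms = j" using Suc.prems(2) ps by simp
    \<comment> \<open>\<open>div_diff\<close> branches on equality of all points, but its quotient
      needs distinct end abscissae. In a multichain, equal ends squeeze everything between them to a
      single point.\<close>
    have ne: "x 0 < x (Suc j)"
    proof (rule ccontr)
      assume "\<not> ?thesis"
      then have pq: "ps ! 0 = ps ! Suc j" using pair[of 0 "Suc j"] by auto
      have "ps ! i = ps ! 0" if "i \<le> Suc j" for i
      proof (cases "i = 0 \<or> i = Suc j")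
        case False
        then show ?thesis using pair[of 0 i] pair[of i "Suc j"] that pq by (auto simp: x_def)
      qed (use pq in auto)
      then have "\<forall>p\<in>set ps. p = hd ps" using Suc.prems(2)
        by (metis in_set_conv_nth less_Suc_eq_le hd_conv_nth list.size(3) nat.distinct(1))
      with False show False by blast
    qed
    have mc: "multichain k (tl ps)" "multichain k (butlast ps)"
      using Suc.prems(1) unfolding multichain_def ps by (auto simp: sorted_wrt_append butlast_append)
    have tl: "div_diff k j (tl ps) = hsym (k - j) (map fst (tl ps))
      + (\<Sum>i\<le>j. e (Suc i) / (\<Prod>l\<in>{..j}-{i}. x (Suc i) - x (Suc l)))"
      using Suc.IH[OF mc(1)] Suc.prems(2,3) by (simp add: nth_tl e_def x_def)
    have bl: "div_diff k j (butlast ps) = hsym (k - j) (map fst (butlast ps))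
      + (\<Sum>i\<le>j. e i / (\<Prod>l\<in>{..j}-{i}. x i - x l))"
      using Suc.IH[OF mc(2)] Suc.prems(2,3) by (simp add: nth_butlast e_def x_def)
    have k: "k - j = Suc (k - Suc j)" using Suc.prems(3) by simp
    have hs: "hsym (k - j) (map fst (tl ps)) - hsym (k - j) (map fst (butlast ps))
      = (x (Suc j) - x 0) * hsym (k - Suc j) (map fst ps)"
      unfolding k using hsym_diff[of "k - Suc j" "map fst ms" "fst q" "fst p"] len
      by (simp add: ps x_def nth_append)
    have er: "(\<Sum>i\<le>j. e (Suc i) / (\<Prod>l\<in>{..j}-{i}. x (Suc i) - x (Suc l)))
       - (\<Sum>i\<le>j. e i / (\<Prod>l\<in>{..j}-{i}. x i - x l))
       = (x (Suc j) - x 0) * (\<Sum>i\<le>Suc j. e i / (\<Prod>l\<in>{..Suc j}-{i}. x i - x l))"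
      by (rule node_error_rec) (use ne simple in auto)
    have "last ps = ps ! Suc j" "hd ps = ps ! 0" using len by (auto simp: ps nth_append)
    then have "fst (last ps) - fst (hd ps) = x (Suc j) - x 0" by (simp add: x_def)
    then have "div_diff k (Suc j) ps
        = (div_diff k j (tl ps) - div_diff k j (butlast ps)) / (x (Suc j) - x 0)"
      using False by (simp only: div_diff.simps if_False)
    also have "div_diff k j (tl ps) - div_diff k j (butlast ps)
        = (x (Suc j) - x 0) * (hsym (k - Suc j) (map fst ps)
          + (\<Sum>i\<le>Suc j. e i / (\<Prod>l\<in>{..Suc j}-{i}. x i - x l)))"
      using hs er unfolding tl bl distrib_left by linarith
    finally show ?thesis using ne by (simp add: e_def x_def)
  qed
qed

subsection \<open>Chains close to the curve\<close>

text \<open>Left of node \<open>i\<close> the distances are at least \<delta>, 2\<delta>, ...,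
  i\<delta>, and right of it \<delta>, ..., (k - i)\<delta>. These multiply to the two
  factorials.\<close>

lemma prod_dist_lower:
  fixes x :: "nat \<Rightarrow> real"
  assumes "0 \<le> \<delta>" "i \<le> k"
    and before: "\<And>l. l < i \<Longrightarrow> real (i - l) * \<delta> \<le> x i - x l"
    and after: "\<And>l. i < l \<Longrightarrow> l \<le> k \<Longrightarrow> real (l - i) * \<delta> \<le> x l - x i"
  shows "fact i * fact (k - i) * \<delta> ^ k \<le> \<bar>\<Prod>l\<in>{..k}-{i}. x i - x l\<bar>"
proof -
  have split: "{..k} - {i} = {..<i} \<union> {i<..k}" "{..<i} \<inter> {i<..k} = {}"
    using \<open>i \<le> k\<close> by auto
  have "(\<Prod>l<i. real (i - l) * \<delta>) = fact i * \<delta> ^ i"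
    by (simp add: prod.distrib fact_prod_rev[of i] atLeast0LessThan)
  moreover have "(\<Prod>l\<in>{i<..k}. real (l - i) * \<delta>) = fact (k - i) * \<delta> ^ (k - i)"
  proof -
    have "(\<Prod>l\<in>{i<..k}. real (l - i)) = (\<Prod>l\<in>{1..k-i}. real l)"
      by (rule prod.reindex_bij_witness[of _ "\<lambda>l. l + i" "\<lambda>l. l - i"]) auto
    then show ?thesis by (simp add: prod.distrib fact_prod[of "k - i"])
  qed
  ultimately have "fact i * fact (k - i) * \<delta> ^ k
      = (\<Prod>l<i. real (i - l) * \<delta>) * (\<Prod>l\<in>{i<..k}. real (l - i) * \<delta>)"
    using \<open>i \<le> k\<close> by (simp add: power_add[symmetric])
  also have "\<dots> \<le> (\<Prod>l<i. \<bar>x i - x l\<bar>) * (\<Prod>l\<in>{i<..k}. \<bar>x i - x l\<bar>)"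
    using \<open>0 \<le> \<delta>\<close> by (intro mult_mono prod_mono prod_nonneg conjI) (use before after in \<open>force+\<close>)
  also have "\<dots> = \<bar>\<Prod>l\<in>{..k}-{i}. x i - x l\<bar>"
    unfolding split(1) abs_prod by (subst prod.union_disjoint) auto
  finally show ?thesis .
qed

lemma sum_inverse_fact_mult:
  "(\<Sum>i\<le>k. 1 / (fact i * fact (k - i))) = (2 ^ k / fact k :: real)"
proof -
  have "(\<Sum>i\<le>k. 1 / (fact i * fact (k - i))) = (\<Sum>i\<le>k. real (k choose i)) / fact k"
    unfolding sum_divide_distrib by (intro sum.cong) (auto simp: binomial_fact)
  also have "(\<Sum>i\<le>k. real (k choose i)) = 2 ^ k"
    using choose_row_sum[of k] by (metis of_nat_numeral of_nat_power of_nat_sum)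
  finally show ?thesis .
qed

lemma sorted_wrt_subseq: "subseq xs ys \<Longrightarrow> sorted_wrt P ys \<Longrightarrow> sorted_wrt P xs"
  by (induction rule: list_emb.induct) (auto dest: list_emb_set)

text \<open>The \<open>k\<close> copies of an end point are not separated from each other. The
  margin \<open>r\<close> compensates: r \<ge> k\<delta> puts all of them as far from an inner node
  as \<open>k\<close> consecutive gaps would. The bound on \<open>h\<close> is the ordinate error
  that the value 1 of the \<open>k\<close>-th divided difference can absorb.\<close>

locale spread_tuple =
  fixes k :: nat and \<delta> r h :: real
  assumes k_pos: "k \<ge> 1" and \<delta>_pos: "\<delta> > 0" and k\<delta>: "real k * \<delta> \<le> r" and r_le: "r \<le> 1 / 2"
    and h_le: "h \<le> fact k * (\<delta> / 2) ^ k"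
begin

lemma \<delta>_le: "\<delta> \<le> r"
proof -
  have "1 * \<delta> \<le> real k * \<delta>" using k_pos \<delta>_pos by (intro mult_right_mono) auto
  then show ?thesis using k\<delta> by simp
qed

lemma r_pos: "r > 0"
  using \<delta>_le \<delta>_pos by simp

definition spread :: "point \<Rightarrow> point \<Rightarrow> bool" where
  "spread p q \<longleftrightarrow> p = q \<and> (p = gam k 0 \<or> p = gam k 1) \<or> fst p + \<delta> \<le> fst q"

definition inner :: "point \<Rightarrow> bool" where
  "inner p \<longleftrightarrow> r \<le> fst p \<and> fst p \<le> 1 - r \<and> \<bar>snd p - fst p ^ k\<bar> \<le> h"

text \<open>End points lie on the curve and drop out of the error sum. Only inner nodes need a lower
  bound on their denominators, and seen from an inner node both the other inner nodes and the end
  points are far enough away.\<close>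

lemma positive_tuple_spread:
  assumes len: "length qs = k + 1" and sorted: "sorted_wrt spread qs"
    and mem: "\<And>p. p \<in> set qs \<Longrightarrow> inner p \<or> p = gam k 0 \<or> p = gam k 1"
  shows "positive_tuple k qs"
proof -
  define x where "x i = fst (qs ! i)" for i
  define e where "e i = snd (qs ! i) - fst (qs ! i) ^ k" for i
  have pair: "spread (qs ! i) (qs ! l)" if "i < l" "l \<le> k" for i l
    using sorted len that by (simp add: sorted_wrt_iff_nth_less)
  have mem': "inner (qs ! i) \<or> qs ! i = gam k 0 \<or> qs ! i = gam k 1" if "i \<le> k" for i
    using mem[of "qs ! i"] len that by simp
  have mc: "multichain k qs"
    using sorted unfolding multichain_def
    by (rule sorted_wrt_mono_rel[rotated]) (use \<delta>_pos in \<open>auto simp: spread_def gam_def\<close>)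
  \<comment> \<open>\<open>spread\<close> gives only one \<delta> per pair, so the gaps of
    consecutive nodes are added up. Abscissae between r and 1 - r exclude the end points, for which
    the gap could be 0.\<close>
  have gap: "real d * \<delta> \<le> x (l + d) - x l" if "l + d \<le> k" "r \<le> x l" "x (l + d) \<le> 1 - r" for l d
    using that
  proof (induction d arbitrary: l)
    case (Suc d)
    have "qs ! l \<noteq> gam k 0" using Suc.prems r_pos by (auto simp: x_def gam_def)
    moreover have "qs ! l \<noteq> gam k 1"
      using pair[of l "l + Suc d"] Suc.prems r_pos \<delta>_pos by (auto simp: x_def gam_def spread_def)
    ultimately have "x l + \<delta> \<le> x (Suc l)"
      using pair[of l "Suc l"] Suc.prems by (auto simp: x_def spread_def)
    moreover from this have "real d * \<delta> \<le> x (Suc l + d) - x (Suc l)"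
      using Suc.prems \<delta>_pos by (intro Suc.IH) auto
    ultimately show ?case by (simp add: algebra_simps)
  qed simp
  have scale: "real m * \<delta> \<le> r" if "m \<le> k" for m
  proof -
    have "real m * \<delta> \<le> real k * \<delta>" using that \<delta>_pos by (intro mult_right_mono) auto
    then show ?thesis using k\<delta> by simp
  qed
  have prod: "fact i * fact (k - i) * \<delta> ^ k \<le> \<bar>\<Prod>l\<in>{..k}-{i}. x i - x l\<bar>"
    if i: "i \<le> k" "inner (qs ! i)" for i
  proof (rule prod_dist_lower)
    have xi: "r \<le> x i" "x i \<le> 1 - r" using i by (auto simp: inner_def x_def)
    fix l
    {
      assume l: "l < i"
      have "qs ! l \<noteq> gam k 1"
        using pair[OF l i(1)] xi r_pos \<delta>_pos by (auto simp: spread_def x_def gam_def)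
      then consider "qs ! l = gam k 0" | "inner (qs ! l)" using mem'[of l] l i by force
      then show "real (i - l) * \<delta> \<le> x i - x l"
      proof cases
        case 1
        then show ?thesis using scale[of "i - l"] xi le_trans[OF diff_le_self i(1), of l] by (auto simp: x_def gam_def)
      next
        case 2
        then show ?thesis using gap[of l "i - l"] l i xi by (simp add: inner_def x_def)
      qed
    }
    {
      assume l: "i < l" "l \<le> k"
      have "qs ! l \<noteq> gam k 0"
        using pair[OF l] xi r_pos \<delta>_pos by (auto simp: spread_def x_def gam_def)
      then consider "qs ! l = gam k 1" | "inner (qs ! l)" using mem'[of l] l i by auto
      then show "real (l - i) * \<delta> \<le> x l - x i"
      proof cases
        case 1
        then show ?thesis using scale[of "l - i"] xi le_trans[OF diff_le_self l(2), of i] l(1) by (auto simp: x_def gam_def)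
      next
        case 2
        then show ?thesis using gap[of i "l - i"] l i xi by (simp add: inner_def x_def)
      qed
    }
  qed (use \<delta>_pos i in auto)
  have term_le: "\<bar>e i / (\<Prod>l\<in>{..k}-{i}. x i - x l)\<bar> \<le> fact k / 2 ^ k * (1 / (fact i * fact (k - i)))"
    if "i \<le> k" for i
  proof (cases "inner (qs ! i)")
    case True
    have "\<bar>e i\<bar> \<le> fact k * (\<delta> / 2) ^ k" using True h_le by (auto simp: inner_def e_def)
    moreover have "0 < fact i * fact (k - i) * \<delta> ^ k" using \<delta>_pos by simp
    ultimately have "\<bar>e i\<bar> / \<bar>\<Prod>l\<in>{..k}-{i}. x i - x l\<bar>
        \<le> fact k * (\<delta> / 2) ^ k / (fact i * fact (k - i) * \<delta> ^ k)"
      using prod[OF that True] by (intro frac_le) auto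
    also have "\<dots> = fact k / 2 ^ k * (1 / (fact i * fact (k - i)))"
      using \<delta>_pos by (simp add: power_divide)
    finally show ?thesis by (simp add: abs_divide)
  next
    case False
    then have "e i = 0" using mem'[OF that] by (auto simp: e_def gam_def)
    then show ?thesis by simp
  qed
  have "\<bar>\<Sum>i\<le>k. e i / (\<Prod>l\<in>{..k}-{i}. x i - x l)\<bar>
      \<le> (\<Sum>i\<le>k. fact k / 2 ^ k * (1 / (fact i * fact (k - i))))"
    by (intro order_trans[OF sum_abs] sum_mono term_le) auto
  \<comment> \<open>The factors k!/2^k and 2^k/k! cancel exactly. The error is thus at most 1 in
    absolute value, while the unperturbed part is \<open>hsym 0 = 1\<close>.\<close>
  also have "\<dots> = 1" by (simp only: sum_distrib_left[symmetric] sum_inverse_fact_mult) simp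
  finally have "-1 \<le> (\<Sum>i\<le>k. e i / (\<Prod>l\<in>{..k}-{i}. x i - x l))" by linarith
  then show ?thesis
    using div_diff_multichain[OF mc, of k] len by (simp add: positive_tuple_def x_def e_def)
qed

text \<open>\<open>spread\<close> holds throughout the padded list and passes to subsequences, so
  \<open>positive_tuple_spread\<close> covers every tuple. The inequalities \<delta> \<le> r \<le>
  1/2 separate the points from the ends and the ends from each other.\<close>

lemma admissible_spread:
  assumes "sorted_wrt (\<lambda>p q. fst p + \<delta> \<le> fst q) ps" "\<And>p. p \<in> set ps \<Longrightarrow> inner p"
  shows "admissible k ps"
proof -
  let ?L = "replicate k (gam k 0) @ ps @ replicate k (gam k 1)"
  have rng: "r \<le> fst p" "fst p \<le> 1 - r" if "p \<in> set ps" for p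
    using assms(2)[OF that] by (auto simp: inner_def)
  have "sorted_wrt spread ps"
    using assms(1) by (rule sorted_wrt_mono_rel[rotated]) (auto simp: spread_def)
  moreover have "sorted_wrt spread (replicate k p)" if "p = gam k 0 \<or> p = gam k 1" for p
    using that by (auto simp: sorted_wrt_iff_nth_less spread_def)
  moreover have "spread (gam k 0) p" "spread p (gam k 1)" if "p \<in> set ps" for p
    using rng[OF that] \<delta>_le by (simp_all add: spread_def gam_def)
  moreover have "spread (gam k 0) (gam k 1)"
    using \<delta>_le r_le by (simp add: spread_def gam_def)
  ultimately have sp: "sorted_wrt spread ?L"
    by (simp add: sorted_wrt_append ball_Un del: split_paired_All split_paired_Ex)
  then have mc: "multichain k ?L"
    unfolding multichain_def
    by (rule sorted_wrt_mono_rel[rotated]) (use \<delta>_pos in \<open>auto simp: spread_def gam_def\<close>)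
  have "positive_tuple k qs" if qs: "subseq qs ?L" "length qs = k + 1" for qs
  proof (rule positive_tuple_spread)
    show "sorted_wrt spread qs" using sorted_wrt_subseq[OF qs(1) sp] .
    fix p assume "p \<in> set qs"
    then have "p \<in> set ?L" using qs(1) by (metis notin_set_nthsI subseq_conv_nths)
    then have "p = gam k 0 \<or> p \<in> set ps \<or> p = gam k 1" by auto
    then show "inner p \<or> p = gam k 0 \<or> p = gam k 1" using assms(2) by blast
  qed fact
  then have km: "k_monotone k ?L" using mc by (simp add: k_monotone_def)
  have "sorted_wrt (\<lambda>p q. fst p < fst q) ps"
    using assms(1) by (rule sorted_wrt_mono_rel[rotated]) (use \<delta>_pos in auto)
  moreover have "fst (gam k 0) < fst p" "fst p < fst (gam k 1)" if "p \<in> set ps" for p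
    using r_pos rng[OF that] by (simp_all add: gam_def)
  moreover have "fst (gam k 0) < fst (gam k 1)" by (simp add: gam_def)
  ultimately have "chain (gam k 0 # ps @ [gam k 1])"
    by (simp add: chain_def sorted_wrt_append ball_Un del: split_paired_All split_paired_Ex)
  then show ?thesis using km by (simp add: admissible_def)
qed

end

lemma admissible_distinct:
  assumes "admissible k ps"
  shows "distinct ps"
proof -
  have "sorted_wrt (<) (map fst ps)"
    using assms by (simp add: admissible_def chain_def sorted_wrt_append sorted_wrt_map)
  then show ?thesis by (simp add: strict_sorted_iff distinct_map)
qed

text \<open>Admissible chains repeat no point, so their length is at most \<open>card X\<close>.
  This gives \<open>Max\<close> in \<open>max_chain_length\<close> its meaning.\<close>

lemma finite_admissible_lengths:
  "finite X \<Longrightarrow> finite {length ps | ps. set ps \<subseteq> X \<and> admissible k ps}"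
  by (rule finite_subset[of _ "{..card X}"])
     (auto, metis admissible_distinct card_mono distinct_card)

section \<open>Cells along the curve and the deterministic lower bound\<close>

context spread_tuple
begin

definition cell :: "real \<Rightarrow> nat \<Rightarrow> point set" where
  "cell w i = {p. r + real i * (w + \<delta>) \<le> fst p \<and> fst p \<le> r + real i * (w + \<delta>) + w
                 \<and> \<bar>snd p - fst p ^ k\<bar> \<le> h}"

lemma occupied_cells_le_max_chain_length:
  assumes fin: "finite X" and w: "0 \<le> w" and N: "real N * (w + \<delta>) \<le> 1 - 2 * r"
  shows "card {i \<in> {..<N}. X \<inter> cell w i \<noteq> {}} \<le> max_chain_length k X"
proof -
  let ?O = "{i \<in> {..<N}. X \<inter> cell w i \<noteq> {}}"
  define f where "f i = (SOME p. p \<in> X \<inter> cell w i)" for i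
  define ps where "ps = map f (sorted_list_of_set ?O)"
  have f: "f i \<in> X" "f i \<in> cell w i" if "i \<in> ?O" for i
    using that someI_ex[of "\<lambda>p. p \<in> X \<inter> cell w i"] by (auto simp: f_def)
  have sp: "fst (f i) + \<delta> \<le> fst (f l)" if "i \<in> ?O" "l \<in> ?O" "i < l" for i l
  proof -
    \<comment> \<open>Cell \<open>i\<close> ends \<delta> before cell \<open>i + 1\<close> starts,
      and \<open>l\<close> is at least \<open>i + 1\<close>.\<close>
    have "real (Suc i) * (w + \<delta>) \<le> real l * (w + \<delta>)"
      using that w \<delta>_pos by (intro mult_right_mono) auto
    then show ?thesis using f(2)[OF that(1)] f(2)[OF that(2)] by (auto simp: cell_def algebra_simps)
  qed
  have inner_f: "inner (f i)" if "i \<in> ?O" for i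
  proof -
    \<comment> \<open>The right end of cell \<open>i\<close> is r + (i + 1)(w + \<delta>) -
      \<delta>, hence below 1 - r by the bound on \<open>N\<close>.\<close>
    have "real (Suc i) * (w + \<delta>) \<le> real N * (w + \<delta>)"
      using that w \<delta>_pos by (intro mult_right_mono) auto
    moreover have "0 \<le> real i * (w + \<delta>)" using w \<delta>_pos by simp
    moreover have "real (Suc i) * (w + \<delta>) = real i * (w + \<delta>) + (w + \<delta>)"
      by (simp add: algebra_simps)
    moreover have "r + real i * (w + \<delta>) \<le> fst (f i)" "fst (f i) \<le> r + real i * (w + \<delta>) + w"
      "\<bar>snd (f i) - fst (f i) ^ k\<bar> \<le> h"
      using f(2)[OF that] by (simp_all add: cell_def)
    ultimately show ?thesis
      unfolding inner_def using w N \<delta>_pos by linarith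
  qed
  have set_ps: "set ps = f ` ?O" by (simp add: ps_def)
  have "inner p" if "p \<in> set ps" for p
    using that inner_f unfolding set_ps by (elim imageE) simp
  moreover have "sorted_wrt (\<lambda>p q. fst p + \<delta> \<le> fst q) ps"
    unfolding ps_def sorted_wrt_map
    by (rule sorted_wrt_mono_rel[OF _ strict_sorted_list_of_set]) (use sp in simp)
  ultimately have adm: "admissible k ps" by (rule admissible_spread[rotated])
  have sub: "set ps \<subseteq> X" unfolding set_ps by (intro image_subsetI f(1))
  have len: "card ?O = length ps" by (simp add: ps_def)
  have "card ?O \<in> {length ps | ps. set ps \<subseteq> X \<and> admissible k ps}"
    by (intro CollectI exI[of _ ps] conjI len sub adm)
  then show ?thesis
    unfolding max_chain_length_def using finite_admissible_lengths[OF fin] by (rule Max_ge[rotated])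
qed

end

subsection \<open>Measurability\<close>

text \<open>Puts 0 among the lengths, so the maximum is over a nonempty set. With no inner points
  any legal parameters serve; here k\<delta> = r = 1/2 and h = 0.\<close>

lemma admissible_Nil:
  assumes "k \<ge> 1"
  shows "admissible k []"
proof -
  interpret spread_tuple k "1 / (2 * real k)" "1 / 2" 0
    using assms by unfold_locales auto
  show ?thesis by (rule admissible_spread) auto
qed

lemma borel_measurable_fst_point [measurable (raw)]:
  fixes g :: "'a \<Rightarrow> point"
  assumes "g \<in> borel_measurable M"
  shows "(\<lambda>\<omega>. fst (g \<omega>)) \<in> borel_measurable M"
  using assms by (rule measurable_compose) (intro borel_measurable_continuous_onI continuous_intros)

lemma borel_measurable_snd_point [measurable (raw)]:
  fixes g :: "'a \<Rightarrow> point"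
  assumes "g \<in> borel_measurable M"
  shows "(\<lambda>\<omega>. snd (g \<omega>)) \<in> borel_measurable M"
  using assms by (rule measurable_compose) (intro borel_measurable_continuous_onI continuous_intros)

lemma pred_point_eq:
  fixes f g :: "'a \<Rightarrow> point"
  assumes [measurable]: "f \<in> borel_measurable M" "g \<in> borel_measurable M"
  shows "Measurable.pred M (\<lambda>\<omega>. f \<omega> = g \<omega>)"
  unfolding prod_eq_iff by measurable

text \<open>A random tuple is a fixed list of random points evaluated at \<omega>. Its length is
  constant, so the recursion can be followed, with the coincidence test as a finite conjunction of
  measurable conditions.\<close>

lemma measurable_div_diff:
  fixes gs :: "('a \<Rightarrow> point) list"
  assumes "\<And>g. g \<in> set gs \<Longrightarrow> g \<in> borel_measurable M" "length gs = Suc j" "j \<le> k"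
  shows "(\<lambda>\<omega>. div_diff k j (map (\<lambda>g. g \<omega>) gs)) \<in> borel_measurable M"
  using assms
proof (induction j arbitrary: gs)
  case 0
  then obtain g where "gs = [g]" by (auto simp: length_Suc_conv)
  then show ?case using "0.prems"(1)[of g] by simp
next
  case (Suc j)
  then have ne: "gs \<noteq> []" by auto
  have [measurable]: "hd gs \<in> borel_measurable M" "last gs \<in> borel_measurable M"
    using Suc.prems(1) ne by auto
  have [measurable]: "Measurable.pred M (\<lambda>\<omega>. \<forall>g\<in>set gs. g \<omega> = hd gs \<omega>)"
    using Suc.prems(1) by (intro pred_intros_finite pred_point_eq) auto
  have [measurable]: "(\<lambda>\<omega>. div_diff k j (map (\<lambda>g. g \<omega>) (tl gs))) \<in> borel_measurable M"
    using Suc.prems by (intro Suc.IH) (auto dest: list.set_sel(2)[OF ne])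
  have [measurable]: "(\<lambda>\<omega>. div_diff k j (map (\<lambda>g. g \<omega>) (butlast gs))) \<in> borel_measurable M"
    using Suc.prems by (intro Suc.IH) (auto dest: in_set_butlastD)
  \<comment> \<open>The closed form of the derivative turns the confluent branch into a monomial in
    one abscissa.\<close>
  have eq: "div_diff k (Suc j) (map (\<lambda>g. g \<omega>) gs) =
     (if \<forall>g\<in>set gs. g \<omega> = hd gs \<omega>
      then fact k / fact (k - Suc j) * fst (hd gs \<omega>) ^ (k - Suc j) / fact (Suc j)
      else (div_diff k j (map (\<lambda>g. g \<omega>) (tl gs)) - div_diff k j (map (\<lambda>g. g \<omega>) (butlast gs)))
        / (fst (last gs \<omega>) - fst (hd gs \<omega>)))" for \<omega>
  proof -
    have ends: "hd (map (\<lambda>g. g \<omega>) gs) = hd gs \<omega>" "last (map (\<lambda>g. g \<omega>) gs) = last gs \<omega>"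
      using ne by (simp_all add: hd_map last_map)
    have "(\<forall>p\<in>set (map (\<lambda>g. g \<omega>) gs). p = hd gs \<omega>) \<longleftrightarrow> (\<forall>g\<in>set gs. g \<omega> = hd gs \<omega>)"
      by auto
    then show ?thesis
      by (simp only: div_diff.simps higher_deriv_power_real[OF Suc.prems(3)] ends map_tl map_butlast)
  qed
  show ?case unfolding eq by measurable
qed

lemma measurable_sorted_wrt_map:
  assumes "\<And>f g. f \<in> set gs \<Longrightarrow> g \<in> set gs \<Longrightarrow> Measurable.pred M (\<lambda>\<omega>. R (f \<omega>) (g \<omega>))"
  shows "Measurable.pred M (\<lambda>\<omega>. sorted_wrt R (map (\<lambda>g. g \<omega>) gs))"
  using assms
proof (induction gs)
  case (Cons f gs)
  have [measurable]: "Measurable.pred M (\<lambda>\<omega>. \<forall>g\<in>set gs. R (f \<omega>) (g \<omega>))"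
    using Cons.prems by (intro pred_intros_finite) auto
  have [measurable]: "Measurable.pred M (\<lambda>\<omega>. sorted_wrt R (map (\<lambda>g. g \<omega>) gs))"
    using Cons.prems by (intro Cons.IH) auto
  show ?case by simp
qed simp

text \<open>Replaces the subsequences of a list depending on \<omega> by evaluations of finitely
  many fixed lists of random points, so that \<open>k_monotone\<close> becomes a finite
  conjunction.\<close>

lemma subseq_map_iff: "subseq qs (map f xs) \<longleftrightarrow> (\<exists>ys\<in>set (List.subseqs xs). qs = map f ys)"
  by (auto simp: set_subseqs_eq subseq_conv_nths nths_map)

lemma measurable_admissible:
  fixes gs :: "('a \<Rightarrow> point) list"
  assumes meas: "\<And>g. g \<in> set gs \<Longrightarrow> g \<in> borel_measurable M"
  shows "Measurable.pred M (\<lambda>\<omega>. admissible k (map (\<lambda>g. g \<omega>) gs))"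
proof -
  have pos: "Measurable.pred M (\<lambda>\<omega>. positive_tuple k (map (\<lambda>g. g \<omega>) hs))"
    if "\<And>h. h \<in> set hs \<Longrightarrow> h \<in> borel_measurable M" "length hs = k + 1" for hs :: "('a \<Rightarrow> point) list"
  proof -
    have [measurable]: "(\<lambda>\<omega>. div_diff k k (map (\<lambda>g. g \<omega>) hs)) \<in> borel_measurable M"
      using that by (intro measurable_div_diff) auto
    show ?thesis using that(2) by (simp add: positive_tuple_def)
  qed
  have mono: "Measurable.pred M (\<lambda>\<omega>. k_monotone k (map (\<lambda>g. g \<omega>) hs))"
    if hs: "\<And>h. h \<in> set hs \<Longrightarrow> h \<in> borel_measurable M" for hs :: "('a \<Rightarrow> point) list"
  proof -
    have 1: "Measurable.pred M (\<lambda>\<omega>. multichain k (map (\<lambda>g. g \<omega>) hs))"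
      unfolding multichain_def gam_def
    proof (intro measurable_sorted_wrt_map)
      fix f g assume "f \<in> set hs" "g \<in> set hs"
      then have [measurable]: "f \<in> borel_measurable M" "g \<in> borel_measurable M" using hs by auto
      show "Measurable.pred M (\<lambda>\<omega>. fst (f \<omega>) < fst (g \<omega>)
          \<or> f \<omega> = g \<omega> \<and> f \<omega> = (fst (f \<omega>), fst (f \<omega>) ^ k))"
        unfolding prod_eq_iff fst_conv snd_conv by measurable
    qed
    have 2: "k_monotone k (map (\<lambda>g. g \<omega>) hs) \<longleftrightarrow> multichain k (map (\<lambda>g. g \<omega>) hs)
        \<and> (\<forall>fs\<in>{fs\<in>set (List.subseqs hs). length fs = k + 1}. positive_tuple k (map (\<lambda>g. g \<omega>) fs))" for \<omega>
      by (auto simp: k_monotone_def subseq_map_iff set_subseqs_eq)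
    have 3: "Measurable.pred M (\<lambda>\<omega>. \<forall>fs\<in>{fs\<in>set (List.subseqs hs). length fs = k + 1}.
        positive_tuple k (map (\<lambda>g. g \<omega>) fs))"
    proof (intro pred_intros_finite pos)
      fix fs h assume "fs \<in> {fs \<in> set (List.subseqs hs). length fs = k + 1}" "h \<in> set fs"
      then have "h \<in> set hs" by (auto simp: set_subseqs_eq subseq_conv_nths dest: in_set_nthsD)
      then show "h \<in> borel_measurable M" by (rule hs)
    qed (rule finite_subset[OF _ finite_set[of "List.subseqs hs"]], auto)
    show ?thesis unfolding 2 using 1 3 by (rule pred_intros_logic)
  qed
  let ?full = "replicate k (\<lambda>_. gam k 0) @ gs @ replicate k (\<lambda>_. gam k 1)"
  let ?ends = "(\<lambda>_. gam k 0) # gs @ [\<lambda>_. gam k 1]"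
  have chain: "Measurable.pred M (\<lambda>\<omega>. chain (map (\<lambda>g. g \<omega>) ?ends))"
    unfolding chain_def
  proof (rule measurable_sorted_wrt_map)
    fix f g assume "f \<in> set ?ends" "g \<in> set ?ends"
    then have [measurable]: "f \<in> borel_measurable M" "g \<in> borel_measurable M" using meas by auto
    show "Measurable.pred M (\<lambda>\<omega>. fst (f \<omega>) < fst (g \<omega>))" by measurable
  qed
  have "Measurable.pred M (\<lambda>\<omega>. k_monotone k (map (\<lambda>g. g \<omega>) ?full))"
    using meas by (intro mono) auto
  with chain have "Measurable.pred M (\<lambda>\<omega>. chain (map (\<lambda>g. g \<omega>) ?ends) \<and> k_monotone k (map (\<lambda>g. g \<omega>) ?full))"
    by (rule pred_intros_logic)
  then show ?thesis by (simp add: admissible_def)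
qed

text \<open>The point set varies with \<omega> but the lists of indices do not, so the maximum is
  taken over a fixed finite family. Distinctness of admissible chains bounds the index lists by
  \<open>card I\<close>. Inadmissible lists count 0, which is harmless since the empty chain attains
  0.\<close>

lemma max_chain_length_image:
  assumes "k \<ge> 1" and fin: "finite I"
  shows "max_chain_length k (X ` I)
    = Max ((\<lambda>is. if admissible k (map X is) then length is else 0) ` {is. set is \<subseteq> I \<and> length is \<le> card I})"
proof -
  define S where "S = {length ps | ps. set ps \<subseteq> X ` I \<and> admissible k ps}"
  define L where "L = {is. set is \<subseteq> I \<and> length is \<le> card I}"
  have finS: "finite S" unfolding S_def using fin by (intro finite_admissible_lengths) auto
  have 0: "0 \<in> S" unfolding S_def using admissible_Nil[OF assms(1)] by force
  have "(\<lambda>is. if admissible k (map X is) then length is else 0) ` L = S"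
  proof (intro equalityI subsetI)
    fix m assume "m \<in> (\<lambda>is. if admissible k (map X is) then length is else 0) ` L"
    then obtain "is" where "is": "is \<in> L" "m = (if admissible k (map X is) then length is else 0)" by auto
    show "m \<in> S"
    proof (cases "admissible k (map X is)")
      case True
      moreover have "set (map X is) \<subseteq> X ` I" using "is"(1) by (auto simp: L_def)
      moreover have "m = length (map X is)" using "is"(2) True by simp
      ultimately show ?thesis unfolding S_def by blast
    qed (use "is" 0 in simp)
  next
    fix m assume "m \<in> S"
    then obtain ps where ps: "m = length ps" "set ps \<subseteq> X ` I" "admissible k ps" by (auto simp: S_def)
    from ps(2) have "ps \<in> lists (X ` I)" by auto
    then obtain "is" where "is": "ps = map X is" "set is \<subseteq> I" by (auto simp: lists_image)
    have "distinct (map X is)" using admissible_distinct ps(3) "is"(1) by simp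
    then have "distinct is" by (simp add: distinct_map)
    then have "length is \<le> card I" using "is"(2) fin by (metis card_mono distinct_card)
    then have "is \<in> L" using "is"(2) by (simp add: L_def)
    then show "m \<in> (\<lambda>is. if admissible k (map X is) then length is else 0) ` L"
      using ps "is" by (intro image_eqI[of _ _ "is"]) auto
  qed
  then show ?thesis by (simp add: max_chain_length_def S_def L_def)
qed

text \<open>The integral of a nonintegrable function is 0 by convention, so a lower bound for the
  expectation requires measurability. Here it follows from writing the length as a maximum of
  finitely many two-valued measurable functions.\<close>

lemma measurable_max_chain_length:
  fixes X :: "'i \<Rightarrow> 'a \<Rightarrow> point"
  assumes "k \<ge> 1" "finite I" and X: "\<And>i. i \<in> I \<Longrightarrow> X i \<in> borel_measurable M"
  shows "(\<lambda>\<omega>. real (max_chain_length k ((\<lambda>i. X i \<omega>) ` I))) \<in> borel_measurable M"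
proof -
  define L where "L = {is. set is \<subseteq> I \<and> length is \<le> card I}"
  have fin: "finite L" unfolding L_def using \<open>finite I\<close> by (rule finite_lists_length_le)
  have "[] \<in> L" by (simp add: L_def)
  then have ne: "L \<noteq> {}" by blast
  define c where "c = (\<lambda>is \<omega>. if admissible k (map (\<lambda>i. X i \<omega>) is) then real (length is) else 0)"
  have eq: "real (max_chain_length k ((\<lambda>i. X i \<omega>) ` I)) = Max ((\<lambda>is. c is \<omega>) ` L)" for \<omega>
  proof -
    have "real (max_chain_length k ((\<lambda>i. X i \<omega>) ` I))
      = Max (real ` (\<lambda>is. if admissible k (map (\<lambda>i. X i \<omega>) is) then length is else 0) ` L)"
      unfolding max_chain_length_image[OF assms(1,2)] L_def[symmetric]
      using fin ne by (intro mono_Max_commute) (auto intro: monoI)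
    also have "\<dots> = Max ((\<lambda>is. c is \<omega>) ` L)"
      unfolding image_image by (intro arg_cong[where f = Max] image_cong) (auto simp: c_def)
    finally show ?thesis .
  qed
  have "c is \<in> borel_measurable M" if "is \<in> L" for "is"
  proof -
    have "Measurable.pred M (\<lambda>\<omega>. admissible k (map (\<lambda>g. g \<omega>) (map X is)))"
      using that X by (intro measurable_admissible) (auto simp: L_def)
    then have [measurable]: "Measurable.pred M (\<lambda>\<omega>. admissible k (map (\<lambda>i. X i \<omega>) is))"
      by (simp add: comp_def)
    show ?thesis unfolding c_def by measurable
  qed
  then show ?thesis unfolding eq using fin by (intro borel_measurable_Max)
qed

subsection \<open>Random points\<close>

text \<open>By Fubini: every vertical section over the base is an interval of length 2h, whatever
  \<open>f\<close> is.\<close>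

lemma emeasure_lborel_strip:
  fixes f :: "real \<Rightarrow> real"
  assumes [measurable]: "f \<in> borel_measurable borel" and "a \<le> b" "0 \<le> h"
  shows "emeasure lborel {p. a \<le> fst p \<and> fst p \<le> b \<and> \<bar>snd p - f (fst p)\<bar> \<le> h}
    = ennreal (2 * (b - a) * h)"
proof -
  let ?S = "{p. a \<le> fst p \<and> fst p \<le> b \<and> \<bar>snd p - f (fst p)\<bar> \<le> h}"
  have "{p \<in> space (lborel \<Otimes>\<^sub>M lborel). a \<le> fst p \<and> fst p \<le> b \<and> \<bar>snd p - f (fst p)\<bar> \<le> h}
      \<in> sets (lborel \<Otimes>\<^sub>M lborel)"
    by measurable
  then have S: "?S \<in> sets (lborel \<Otimes>\<^sub>M lborel)" by (simp add: space_pair_measure)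
  have sec: "emeasure lborel (Pair x -` ?S) = ennreal (2 * h) * indicator {a..b} x" for x
  proof (cases "x \<in> {a..b}")
    case True
    then have "Pair x -` ?S = {f x - h..f x + h}" by (auto simp: abs_le_iff)
    then show ?thesis using True \<open>0 \<le> h\<close> by simp
  qed auto
  have "emeasure lborel ?S = emeasure (lborel \<Otimes>\<^sub>M lborel) ?S" by (simp add: lborel_prod)
  also have "\<dots> = (\<integral>\<^sup>+x. ennreal (2 * h) * indicator {a..b} x \<partial>lborel)"
    using lborel.emeasure_pair_measure_alt[OF S] unfolding sec .
  also have "\<dots> = ennreal (2 * h) * ennreal (b - a)"
    using \<open>a \<le> b\<close> by (subst nn_integral_cmult_indicator) auto
  also have "\<dots> = ennreal (2 * (b - a) * h)"
    using \<open>0 \<le> h\<close> \<open>a \<le> b\<close> by (simp add: ennreal_mult'[symmetric] mult_ac)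
  finally show ?thesis .
qed

lemma emeasure_unit_square: "emeasure lborel ({0..1::real} \<times> {0..1::real}) = 1"
proof -
  have "emeasure (lborel \<Otimes>\<^sub>M lborel) ({0..1::real} \<times> {0..1::real}) = 1"
    by (subst lborel.emeasure_pair_measure_Times) auto
  then show ?thesis by (simp add: lborel_prod)
qed

text \<open>By independence all points miss \<open>A\<close> with probability (1 - a)^|I|, and 1 - a
  \<le> exp(-a). Raising this to a power uses 1 - a \<ge> 0, true as \<open>a\<close> is a
  probability.\<close>

lemma (in prob_space) prob_hit_ge:
  fixes X :: "'i \<Rightarrow> 'a \<Rightarrow> point"
  assumes indep: "indep_vars (\<lambda>_. borel) X I" and I: "finite I" "I \<noteq> {}"
    and A: "A \<in> sets borel" "\<And>i. i \<in> I \<Longrightarrow> prob (X i -` A \<inter> space M) = a"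
  shows "1 - exp (- (real (card I) * a)) \<le> prob {\<omega> \<in> space M. \<exists>i\<in>I. X i \<omega> \<in> A}"
proof -
  have X [measurable]: "X i \<in> borel_measurable M" if "i \<in> I" for i
    using indep that by (auto simp: indep_vars_def)
  have E: "X i -` A \<inter> space M \<in> events" if "i \<in> I" for i
    using X[OF that] A(1) by (rule measurable_sets)
  have hit: "{\<omega> \<in> space M. \<exists>i\<in>I. X i \<omega> \<in> A} = (\<Union>i\<in>I. X i -` A \<inter> space M)"
    by (rule set_eqI) (auto simp only: mem_Collect_eq UN_iff Int_iff vimage_eq Bex_def)
  have "prob (space M - {\<omega> \<in> space M. \<exists>i\<in>I. X i \<omega> \<in> A}) = prob (\<Inter>i\<in>I. X i -` (- A) \<inter> space M)"
    using I(2) by (intro arg_cong[where f = prob]) auto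
  also have "\<dots> = (\<Prod>i\<in>I. prob (X i -` (- A) \<inter> space M))"
    using A(1) by (intro indep_varsD_finite[OF indep I(2,1)]) auto
  also have "\<dots> = (\<Prod>i\<in>I. 1 - a)"
  proof (intro prod.cong refl)
    fix i assume i: "i \<in> I"
    have "X i -` (- A) \<inter> space M = space M - (X i -` A \<inter> space M)" by auto
    then show "prob (X i -` (- A) \<inter> space M) = 1 - a" using prob_compl[OF E[OF i]] A(2)[OF i] by simp
  qed
  also have "\<dots> = (1 - a) ^ card I" by simp
  also have "\<dots> \<le> exp (- a) ^ card I"
  proof (rule power_mono)
    show "1 - a \<le> exp (- a)" using exp_ge_add_one_self[of "- a"] by simp
    obtain i where "i \<in> I" using I(2) by auto
    then show "0 \<le> 1 - a" using A(2) prob_le_1 by force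
  qed
  also have "\<dots> = exp (- (real (card I) * a))" by (simp add: exp_of_nat_mult[symmetric])
  finally have "prob (space M - {\<omega> \<in> space M. \<exists>i\<in>I. X i \<omega> \<in> A}) \<le> exp (- (real (card I) * a))" .
  moreover have "{\<omega> \<in> space M. \<exists>i\<in>I. X i \<omega> \<in> A} \<in> events"
    unfolding hit using I(1) E by (intro sets.finite_UN) auto
  ultimately show ?thesis using prob_compl by force
qed

lemma max_chain_length_le_card:
  assumes "k \<ge> 1" "finite X"
  shows "max_chain_length k X \<le> card X"
proof -
  let ?S = "{length ps | ps. set ps \<subseteq> X \<and> admissible k ps}"
  have "?S \<noteq> {}" using admissible_Nil[OF assms(1)] by force
  then have "Max ?S \<in> ?S" by (rule Max_in[OF finite_admissible_lengths[OF assms(2)]])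
  then obtain ps where "Max ?S = length ps" "set ps \<subseteq> X" "admissible k ps" by blast
  then show ?thesis
    using assms(2) by (metis max_chain_length_def admissible_distinct card_mono distinct_card)
qed

text \<open>The number of occupied cells is a sum of indicators below the chain length, and
  linearity of expectation applies whatever the dependence between cells. The condition h \<le> r^k
  keeps the cells inside the square, so that their area is their probability.\<close>

lemma (in prob_space) expectation_max_chain_length_ge:
  fixes X :: "nat \<Rightarrow> 'a \<Rightarrow> point"
  assumes tuple: "spread_tuple k \<delta> r h" and "n \<ge> 1"
    and indep: "indep_vars (\<lambda>_. borel) X {..<n}"
    and unif: "\<And>j. j < n \<Longrightarrow> distr M borel (X j) = uniform_measure lborel ({0..1} \<times> {0..1})"
    and "0 \<le> w" "0 \<le> h" "h \<le> r ^ k" and N: "real N * (w + \<delta>) \<le> 1 - 2 * r"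
  shows "real N * (1 - exp (- (real n * (2 * w * h))))
    \<le> expectation (\<lambda>\<omega>. real (max_chain_length k ((\<lambda>j. X j \<omega>) ` {..<n})))"
proof -
  interpret spread_tuple k \<delta> r h by fact
  have X: "X j \<in> borel_measurable M" if "j < n" for j
    using indep that by (auto simp: indep_vars_def)
  have rk: "r ^ k \<le> r"
    using power_decreasing[of 1 k r] k_pos r_pos r_le by simp
  have meas: "(\<lambda>\<omega>. real (max_chain_length k ((\<lambda>j. X j \<omega>) ` {..<n}))) \<in> borel_measurable M"
    using k_pos X by (intro measurable_max_chain_length) auto
  have int: "integrable M (\<lambda>\<omega>. real (max_chain_length k ((\<lambda>j. X j \<omega>) ` {..<n})))"
  proof (rule integrable_const_bound[where B = "real n"])
    have "max_chain_length k ((\<lambda>j. X j \<omega>) ` {..<n}) \<le> n" for \<omega>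
      using max_chain_length_le_card[OF k_pos, of "(\<lambda>j. X j \<omega>) ` {..<n}"]
        card_image_le[of "{..<n}" "\<lambda>j. X j \<omega>"] by simp
    then show "AE \<omega> in M. norm (real (max_chain_length k ((\<lambda>j. X j \<omega>) ` {..<n}))) \<le> real n" by simp
  qed (fact meas)
  have em_cell: "emeasure lborel (cell w i) = ennreal (2 * w * h)" for i
    using emeasure_lborel_strip[of "\<lambda>x. x ^ k" "r + real i * (w + \<delta>)" "r + real i * (w + \<delta>) + w" h]
      \<open>0 \<le> w\<close> \<open>0 \<le> h\<close> by (simp add: cell_def)
  have cell_sets: "cell w i \<in> sets borel" for i
  proof -
    have "{p \<in> space borel. r + real i * (w + \<delta>) \<le> fst p \<and> fst p \<le> r + real i * (w + \<delta>) + w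
                 \<and> \<bar>snd p - fst p ^ k\<bar> \<le> h} \<in> sets (borel :: point measure)"
      by measurable
    then show ?thesis by (simp add: cell_def)
  qed
  have cell_sub: "cell w i \<subseteq> {0..1} \<times> {0..1}" if i: "i < N" for i
  proof
    fix p assume p: "p \<in> cell w i"
    have "real (Suc i) * (w + \<delta>) \<le> real N * (w + \<delta>)"
      using i \<open>0 \<le> w\<close> \<delta>_pos by (intro mult_right_mono) auto
    moreover have "real (Suc i) * (w + \<delta>) = real i * (w + \<delta>) + (w + \<delta>)"
      by (simp add: algebra_simps)
    moreover have "0 \<le> real i * (w + \<delta>)" using \<open>0 \<le> w\<close> \<delta>_pos by simp
    moreover have "r + real i * (w + \<delta>) \<le> fst p" "fst p \<le> r + real i * (w + \<delta>) + w"
      and near: "\<bar>snd p - fst p ^ k\<bar> \<le> h"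
      using p by (simp_all add: cell_def)
    ultimately have x: "r \<le> fst p" "fst p \<le> 1 - r" using N \<delta>_pos by linarith+
    \<comment> \<open>At the bottom x^k \<ge> r^k \<ge> h keeps the cell above 0; at the top x^k + h
      \<le> x + r \<le> 1.\<close>
    have "r ^ k \<le> fst p ^ k" using x r_pos by (intro power_mono) auto
    moreover have "fst p ^ k \<le> fst p" using power_decreasing[of 1 k "fst p"] k_pos x r_pos by simp
    ultimately have "0 \<le> snd p" "snd p \<le> 1" using near \<open>h \<le> r ^ k\<close> rk x by linarith+
    then show "p \<in> {0..1} \<times> {0..1}" using x r_pos by (cases p) auto
  qed
  have prob_cell: "prob (X j -` cell w i \<inter> space M) = 2 * w * h" if "j < n" "i < N" for i j
  proof -
    have "prob (X j -` cell w i \<inter> space M) = measure (distr M borel (X j)) (cell w i)"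
      using X[OF that(1)] cell_sets by (simp add: measure_distr)
    also have "\<dots> = measure lborel (({0..1} \<times> {0..1}) \<inter> cell w i)"
      unfolding unif[OF that(1)] using cell_sets emeasure_unit_square
      by (subst measure_uniform_measure) (auto simp: measure_def)
    also have "({0..1} \<times> {0..1}) \<inter> cell w i = cell w i" using cell_sub[OF that(2)] by auto
    finally show ?thesis using em_cell[of i] \<open>0 \<le> w\<close> \<open>0 \<le> h\<close> by (simp add: measure_def)
  qed
  define H where "H i = {\<omega> \<in> space M. \<exists>j\<in>{..<n}. X j \<omega> \<in> cell w i}" for i
  have H_eq: "H i = (\<Union>j\<in>{..<n}. X j -` cell w i \<inter> space M)" for i
    unfolding H_def by (rule set_eqI) (auto simp only: mem_Collect_eq UN_iff Int_iff vimage_eq Bex_def)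
  have H: "H i \<in> events" for i
    unfolding H_eq using X cell_sets by (intro sets.finite_UN measurable_sets) auto
  have "1 - exp (- (real n * (2 * w * h))) \<le> prob (H i)" if "i < N" for i
    using prob_hit_ge[OF indep _ _ cell_sets, of i "2 * w * h"] prob_cell that \<open>n \<ge> 1\<close>
    by (simp add: H_def lessThan_empty_iff)
  then have "(\<Sum>i<N. 1 - exp (- (real n * (2 * w * h)))) \<le> (\<Sum>i<N. prob (H i))"
    by (intro sum_mono) auto
  also have "\<dots> = expectation (\<lambda>\<omega>. \<Sum>i<N. indicator (H i) \<omega>)"
    using H by (subst Bochner_Integration.integral_sum) (auto simp: less_top[symmetric])
  also have "\<dots> \<le> expectation (\<lambda>\<omega>. real (max_chain_length k ((\<lambda>j. X j \<omega>) ` {..<n})))"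
  proof (rule integral_mono[OF _ int])
    show "integrable M (\<lambda>\<omega>. \<Sum>i<N. indicator (H i) \<omega> :: real)"
      using H by (intro Bochner_Integration.integrable_sum) (auto simp: less_top[symmetric])
    fix \<omega> assume \<omega>: "\<omega> \<in> space M"
    have "(\<Sum>i<N. indicator (H i) \<omega> :: real) = real (card {i \<in> {..<N}. \<omega> \<in> H i})"
      by (simp add: indicator_def sum.If_cases Int_def)
    also have "{i \<in> {..<N}. \<omega> \<in> H i} = {i \<in> {..<N}. (\<lambda>j. X j \<omega>) ` {..<n} \<inter> cell w i \<noteq> {}}"
      using \<omega> by (auto simp: H_def)
    finally show "(\<Sum>i<N. indicator (H i) \<omega>) \<le> real (max_chain_length k ((\<lambda>j. X j \<omega>) ` {..<n}))"
      using occupied_cells_le_max_chain_length[OF _ \<open>0 \<le> w\<close> N, of "(\<lambda>j. X j \<omega>) ` {..<n}"] by simp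
  qed
  finally show ?thesis by simp
qed

section \<open>Choice of constants and passage to the limit\<close>

text \<open>The right-hand side will be \<open>n\<close> times the area of a cell. Induction gives k
  + 1 \<le> 2 k!, making the first factor at least 2, and (1 + 1/k)^k \<le> e \<le> 3 makes the
  power at least 1/3.\<close>

lemma cell_area_constant:
  assumes "k \<ge> 1"
  shows "2 / 3 \<le> 4 * fact k / (real k + 1) * (real k / (real k + 1)) ^ k"
proof -
  have k: "real k > 0" using assms by simp
  have "real k + 1 \<le> 2 * fact k"
    using assms
  proof (induction k rule: dec_induct)
    case (step m)
    have "1 * fact m \<le> real m * fact m" using step by (intro mult_right_mono) auto
    moreover have "fact (Suc m) = real m * fact m + (fact m :: real)" by (simp add: algebra_simps)
    ultimately show ?case using step by linarith
  qed simp
  then have 1: "2 \<le> 4 * fact k / (real k + 1)" by (simp add: field_simps)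
  have "(1 + 1 / real k) ^ k \<le> exp (1 / real k) ^ k"
    by (intro power_mono) (use k in auto)
  also have "\<dots> = exp 1" using k by (simp add: exp_of_nat_mult[symmetric])
  finally have "(1 + 1 / real k) ^ k \<le> 3" using exp_le by linarith
  moreover have "(real k / (real k + 1)) ^ k = 1 / (1 + 1 / real k) ^ k"
    using k by (simp add: power_one_over[symmetric] divide_simps)
  moreover have "0 < (1 + 1 / real k) ^ k" using k by (simp add: add_pos_pos)
  ultimately have 2: "1 / 3 \<le> (real k / (real k + 1)) ^ k"
    using frac_le[of 1 1 "(1 + 1 / real k) ^ k" 3] by simp
  have "2 * (1 / 3) \<le> 4 * fact k / (real k + 1) * (real k / (real k + 1)) ^ k"
    using 1 2 by (intro mult_mono) auto
  then show ?thesis by simp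
qed

theorem proposition2p3:
  fixes k :: nat
    and M :: "nat \<Rightarrow> 'a measure"
    and X :: "nat \<Rightarrow> nat \<Rightarrow> 'a \<Rightarrow> real \<times> real"
    and \<alpha> :: real
  assumes "k \<ge> 1"
    and "\<And>n. n \<ge> 1 \<Longrightarrow> prob_space (M n)"
    and "\<And>n. n \<ge> 1 \<Longrightarrow> prob_space.indep_vars (M n) (\<lambda>_. borel) (X n) {..<n}"
    and "\<And>n i. n \<ge> 1 \<Longrightarrow> i < n \<Longrightarrow>
           distr (M n) borel (X n i) = uniform_measure lborel ({0..1} \<times> {0..1})"
    and "(\<lambda>n. real n powr (- 1 / (real k + 1)) *
            prob_space.expectation (M n)
              (\<lambda>\<omega>. real (max_chain_length k ((\<lambda>i. X n i \<omega>) ` {..<n}))))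
          \<longlonglongrightarrow> \<alpha>"
  shows "\<alpha> \<ge> 1 / 6"
proof -
  define E where "E n = prob_space.expectation (M n)
      (\<lambda>\<omega>. real (max_chain_length k ((\<lambda>i. X n i \<omega>) ` {..<n})))" for n
  \<comment> \<open>The period of the cells. The exponent makes (c/2)^(k+1) = 1/n, which cancels
    \<open>n\<close> in the expected number of points per cell.\<close>
  define c where "c n = 2 * real n powr (- 1 / (real k + 1))" for n
  \<comment> \<open>For a fixed period the cell area is proportional to w \<delta>^k, which is
    largest at \<delta> = k w.\<close>
  define w where "w n = c n / (real k + 1)" for n
  define \<delta> where "\<delta> n = c n * (real k / (real k + 1))" for n
  define h where "h n = fact k * (\<delta> n / 2) ^ k" for n
  have c0: "c \<longlonglongrightarrow> 0"
  proof -
    have "((\<lambda>n. real n powr (- (1 / (real k + 1)))) \<longlongrightarrow> 0) sequentially"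
      by (intro tendsto_neg_powr filterlim_real_sequentially) auto
    from tendsto_mult_right_zero[OF this, of 2] show ?thesis by (simp add: c_def[abs_def])
  qed
  then have \<delta>0: "\<delta> \<longlonglongrightarrow> 0" unfolding \<delta>_def[abs_def] by (rule tendsto_mult_left_zero)
  have "(\<lambda>n. real k * \<delta> n) \<longlonglongrightarrow> 0" using \<delta>0 by (rule tendsto_mult_right_zero)
  \<comment> \<open>The margin is fixed at r = 1/16. As \<delta> and h tend to 0, eventually
    k\<delta> \<le> r and h \<le> r^k.\<close>
  then have ev1: "\<forall>\<^sub>F n in sequentially. real k * \<delta> n < 1 / 16"
    by (rule order_tendstoD) simp
  have h0: "h \<longlonglongrightarrow> fact k * (0 / 2) ^ k"
    unfolding h_def[abs_def] by (intro tendsto_intros \<delta>0) auto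
  have "fact k * (0 / 2) ^ k = (0::real)" using \<open>k \<ge> 1\<close> by simp
  with h0 have "h \<longlonglongrightarrow> 0" by (simp only:)
  then have ev2: "\<forall>\<^sub>F n in sequentially. h n < (1 / 16) ^ k"
    by (rule order_tendstoD) simp
  \<comment> \<open>About 7/(8c) cells, each occupied with probability at least 2/5, times the
    normalisation c/2. Rounding in \<open>N\<close> costs at most one cell, which is the term
    c/5.\<close>
  have bound: "(7 / 8 - c n) / 5 \<le> real n powr (- 1 / (real k + 1)) * E n"
    if n: "n \<ge> 1" and small: "real k * \<delta> n < 1 / 16" "h n < (1 / 16) ^ k" for n
  proof -
    interpret prob_space "M n" using assms(2) n by blast
    have cpos: "c n > 0" using n by (simp add: c_def)
    have wd: "w n + \<delta> n = c n"
      by (simp add: w_def \<delta>_def divide_simps) (simp add: algebra_simps)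
    have pos: "w n \<ge> 0" "\<delta> n > 0" "h n \<ge> 0"
      using cpos \<open>k \<ge> 1\<close> by (auto simp: w_def \<delta>_def h_def)
    have tuple: "spread_tuple k (\<delta> n) (1 / 16) (h n)"
      using small pos \<open>k \<ge> 1\<close> by unfold_locales (auto simp: h_def)
    define N where "N = nat \<lfloor>(7 / 8) / c n\<rfloor>"
    have N: "real N \<le> (7 / 8) / c n" "(7 / 8) / c n - 1 \<le> real N"
      using cpos by (auto simp: N_def)
    have "real N * c n \<le> 7 / 8" using N(1) cpos by (simp add: field_simps)
    then have Nc: "real N * (w n + \<delta> n) \<le> 1 - 2 * (1 / 16)" unfolding wd by simp
    have "(c n / 2) ^ (k + 1) = 1 / real n"
    proof -
      have "(real n powr (- 1 / (real k + 1))) ^ (k + 1) = real n powr (- 1 / (real k + 1) * real (k + 1))"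
        using n by (subst powr_realpow[symmetric]) (simp, rule powr_powr)
      also have "- 1 / (real k + 1) * real (k + 1) = - 1" by (simp add: field_simps)
      finally show ?thesis using n by (simp add: c_def powr_minus_divide)
    qed
    moreover have "2 * w n * h n
        = (c n / 2) ^ (k + 1) * (4 * fact k / (real k + 1) * (real k / (real k + 1)) ^ k)"
    proof -
      have half: "\<delta> n / 2 = c n / 2 * (real k / (real k + 1))" by (simp add: \<delta>_def)
      have "h n = fact k * ((c n / 2) ^ k * (real k / (real k + 1)) ^ k)"
        unfolding h_def half power_mult_distrib ..
      moreover have "2 * (c n / (real k + 1)) * (fact k * (A * B))
          = c n / 2 * A * (4 * fact k / (real k + 1) * B)" for A B
        by (simp add: field_simps)
      ultimately show ?thesis by (simp only: w_def power_Suc Suc_eq_plus1[symmetric])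
    qed
    ultimately have "real n * (2 * w n * h n) = 4 * fact k / (real k + 1) * (real k / (real k + 1)) ^ k"
      using n by simp
    then have area: "2 / 3 \<le> real n * (2 * w n * h n)"
      using cell_area_constant[OF \<open>k \<ge> 1\<close>] by simp
    \<comment> \<open>From exp x \<ge> 1 + x: exp(-2/3) \<le> 3/5, whence the occupation probability
      2/5.\<close>
    have "5 / 3 \<le> exp (2 / 3 :: real)" using exp_ge_add_one_self[of "2 / 3 :: real"] by simp
    also have "\<dots> \<le> exp (real n * (2 * w n * h n))" using area by simp
    finally have "2 / 5 \<le> 1 - exp (- (real n * (2 * w n * h n)))"
      unfolding exp_minus by (simp add: divide_simps)
    then have "real N * (2 / 5) \<le> real N * (1 - exp (- (real n * (2 * w n * h n))))"
      by (intro mult_left_mono) auto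
    also have "\<dots> \<le> E n"
      unfolding E_def
      using expectation_max_chain_length_ge[OF tuple n assms(3)[OF n] assms(4)[OF n] pos(1,3) _ Nc] small
      by simp
    finally have "c n / 2 * (((7 / 8) / c n - 1) * (2 / 5)) \<le> c n / 2 * E n"
      using N(2) cpos by (intro mult_left_mono) auto
    also have "c n / 2 * (((7 / 8) / c n - 1) * (2 / 5)) = (7 / 8 - c n) / 5"
      using cpos by (simp add: field_simps)
    finally show ?thesis by (simp add: c_def)
  qed
  have "\<forall>\<^sub>F n in sequentially. (7 / 8 - c n) / 5 \<le> real n powr (- 1 / (real k + 1)) * E n"
    using ev1 ev2 eventually_ge_at_top[of 1] by eventually_elim (rule bound)
  moreover have "(\<lambda>n. (7 / 8 - c n) / 5) \<longlonglongrightarrow> (7 / 8 - 0) / 5"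
    by (intro tendsto_intros c0) auto
  \<comment> \<open>The limiting bound 7/40 slightly exceeds 1/6.\<close>
  ultimately have "(7 / 8 - 0) / 5 \<le> \<alpha>"
    using assms(5) unfolding E_def by (intro tendsto_le[OF sequentially_bot])
  then show ?thesis by simp
qed

end
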